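(* Let $r\ge 1$ and let $\tilde\alpha$ be the highest root of $\mathfrak{sl}_{r+1}=\mathfrak{sl}_{r+1}(\mathbb C)$. Then the Weyl alternation set $\mathcal A(\tilde\alpha,0)$ has cardinality $|\mathcal A(\tilde\alpha,0)|=F_r$, where $F_r$ denotes the $r$-th Fibonacci number.
   Context: Fibonacci numbers: $F_1=F_2=1$ and $F_n=F_{n-1}+F_{n-2}$ for $n\ge 3$. Setting: let $n=r+1$, $\mathfrak g=\mathfrak{sl}_n(\mathbb C)$, with Cartan subalgebra $\mathfrak h$ of diagonal trace-zero matrices and Borel subalgebra of upper triangular trace-zero matrices. For $1\le i\le n$ let $\varepsilon_i\in\mathfrak h^*$ send a diagonal matrix to its $i$-th entry (so $\varepsilon_1+\cdots+\varepsilon_n=0$ on $\mathfrak h$). The Weyl group is $W=S_n$, acting on $\mathfrak h^*$ by $\sigma(\varepsilon_i)=\varepsilon_{\sigma(i)}$. The positive roots are $\Phi^+=\{\varepsilon_i-\varepsilon_j: 1\le i<j\le n\}$, the highest root is $\tilde\alpha=\varepsilon_1-\varepsilon_n$, and $\rho=\frac12\sum_{\alpha\in\Phi^+}\alpha$. Kostant's partition function: for $\xi\in\mathfrak h^*$, $\wp(\xi)$ is the number of ways to write $\xi$ as a non-negative integral sum of positive roots (i.e. the number of functions $m:\Phi^+\to\{0,1,2,\dots\}$ with $\sum_{\beta\in\Phi^+}m(\beta)\beta=\xi$). Weyl alternation set: for dominant integral weights $\lambda,\mu$, $\mathcal A(\lambda,\mu)=\{\sigma\in W:\wp(\sigma(\lambda+\rho)-(\mu+\rho))>0\}$.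 *)

theory Defs
  imports
    "Jordan_Normal_Form.Matrix"
    "HOL-Number_Theory.Fib"
    "HOL-Combinatorics.Permutations"
    "HOL-Library.FuncSet"
    "HOL-Library.Function_Algebras"
begin

text \<open>
  Diagonal positions are numbered from 0, as matrix entries are: \<open>eps n i\<close> is the functional
  usually written $\varepsilon_{i+1}$, and the Weyl group permutes \<open>{0..<n}\<close>.
\<close>

definition special_linear :: "nat \<Rightarrow> complex mat set" where
  "special_linear n = {A \<in> carrier_mat n n. (\<Sum>i<n. A $$ (i, i)) = 0}"

definition cartan :: "nat \<Rightarrow> complex mat set" where
  "cartan n = {H \<in> special_linear n. diagonal_mat H}"

text \<open>
  A functional on the Cartan subalgebra is represented by its extension by 0 to all complex
  matrices. Equality of such functions is then equality on \<open>cartan n\<close>, and the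
  vector space operations are the pointwise ones. In particular
  \<open>(\<Sum>i<n. eps n i) = 0\<close>.
\<close>

type_synonym weight = "complex mat \<Rightarrow> complex"

definition cartan_dual :: "nat \<Rightarrow> weight set" where
  "cartan_dual n = {\<xi>.
     (\<forall>H \<in> cartan n. \<forall>K \<in> cartan n. \<xi> (H + K) = \<xi> H + \<xi> K) \<and>
     (\<forall>c. \<forall>H \<in> cartan n. \<xi> (c \<cdot>\<^sub>m H) = c * \<xi> H) \<and>
     (\<forall>H. H \<notin> cartan n \<longrightarrow> \<xi> H = 0)}"

definition eps :: "nat \<Rightarrow> nat \<Rightarrow> weight" where
  "eps n i = (\<lambda>H. if H \<in> cartan n then H $$ (i, i) else 0)"

definition positive_roots :: "nat \<Rightarrow> weight set" where
  "positive_roots n = {eps n i - eps n j | i j. i < j \<and> j < n}"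

definition highest_root :: "nat \<Rightarrow> weight" where
  "highest_root n = eps n 0 - eps n (n - 1)"

definition rho :: "nat \<Rightarrow> weight" where
  "rho n = (\<lambda>H. (1 / 2) * (\<Sum>\<alpha> \<in> positive_roots n. \<alpha> H))"

definition weyl_group :: "nat \<Rightarrow> (nat \<Rightarrow> nat) set" where
  "weyl_group n = {\<sigma>. \<sigma> permutes {0..<n}}"

text \<open>
  The linear action on functionals with \<open>\<sigma> (\<epsilon>\<^sub>i) = \<epsilon>\<^bsub>\<sigma> i\<^esub>\<close>
  (see \<open>weyl_act_eps\<close>): precompose with the map of the Cartan subalgebra
  that moves the entry at position \<open>\<sigma> i\<close> to position \<open>i\<close>.
\<close>

definition weyl_act :: "nat \<Rightarrow> (nat \<Rightarrow> nat) \<Rightarrow> weight \<Rightarrow> weight" where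
  "weyl_act n \<sigma> \<xi> =
     (\<lambda>H. if H \<in> cartan n then \<xi> (mat n n (\<lambda>(i, j). H $$ (\<sigma> i, \<sigma> j))) else 0)"

text \<open>
  The set counted here is always finite (\<open>finite_kostant\<close>), so \<open>card\<close> is the
  true count. Multiplicity functions are extensional, so that each one is counted once.
\<close>

definition kostant_partition :: "nat \<Rightarrow> weight \<Rightarrow> nat" where
  "kostant_partition n \<xi> =
     card {m \<in> positive_roots n \<rightarrow>\<^sub>E (UNIV :: nat set).
             (\<lambda>H. \<Sum>\<beta> \<in> positive_roots n. of_nat (m \<beta>) * \<beta> H) = \<xi>}"

definition weyl_alternation_set :: "nat \<Rightarrow> weight \<Rightarrow> weight \<Rightarrow> (nat \<Rightarrow> nat) set" where
  "weyl_alternation_set n lam \<mu> =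
     {\<sigma> \<in> weyl_group n.
        kostant_partition n (weyl_act n \<sigma> (lam + rho n) - (\<mu> + rho n)) > 0}"

lemma permuted_in_cartan:
  assumes "\<sigma> permutes {0..<n}" "H \<in> cartan n"
  shows "mat n n (\<lambda>(i, j). H $$ (\<sigma> i, \<sigma> j)) \<in> cartan n"
proof -
  have lt: "\<sigma> i < n" if "i < n" for i
    using permutes_in_image[OF assms(1), of i] that by simp
  have inj: "\<sigma> i \<noteq> \<sigma> j" if "i \<noteq> j" for i j
    using permutes_inj[OF assms(1)] that by (auto dest: injD)
  have "(\<Sum>i<n. H $$ (\<sigma> i, \<sigma> i)) = (\<Sum>i<n. H $$ (i, i))"
    using sum.permute[of \<sigma> "{..<n}" "\<lambda>i. H $$ (i, i)"] assms(1)
    by (simp add: o_def atLeast0LessThan)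
  then show ?thesis
    using assms(2) lt inj
    by (auto simp: cartan_def special_linear_def diagonal_mat_def)
qed

lemma weyl_act_eps:
  assumes "\<sigma> \<in> weyl_group n" "i < n"
  shows "weyl_act n \<sigma> (eps n i) = eps n (\<sigma> i)"
  using assms permuted_in_cartan[of \<sigma> n]
  by (auto simp: weyl_act_def eps_def weyl_group_def fun_eq_iff)

lemma eps_in_cartan_dual:
  assumes "i < n"
  shows "eps n i \<in> cartan_dual n"
  using assms
  by (auto simp: cartan_dual_def eps_def cartan_def special_linear_def diagonal_mat_def
      sum.distrib sum_distrib_left[symmetric])

lemma finite_positive_roots: "finite (positive_roots n)"
proof (rule finite_subset)
  show "positive_roots n \<subseteq> (\<lambda>(i, j). eps n i - eps n j) ` ({..<n} \<times> {..<n})"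
    by (force simp: positive_roots_def)
qed auto

lemma finite_kostant:
  "finite {m \<in> positive_roots n \<rightarrow>\<^sub>E (UNIV :: nat set).
             (\<lambda>H. \<Sum>\<beta> \<in> positive_roots n. of_nat (m \<beta>) * \<beta> H) = \<xi>}"
proof -
  (* every positive root takes a value at least 1 at H *)
  define H :: "complex mat" where
    "H = mat n n (\<lambda>(i, j). if i = j then of_real ((real n - 1) / 2 - real i) else 0)"
  have "(\<Sum>i<k. (real n - 1) / 2 - real i) = real k * (real n - real k) / 2" for k
    by (induction k) (auto simp: field_simps)
  from this[of n] have "(\<Sum>i<n. (real n - 1) / 2 - real i) = 0"
    by (simp only: diff_self mult_zero_right div_0)
  moreover have "(\<Sum>i<n. H $$ (i, i)) = of_real (\<Sum>i<n. (real n - 1) / 2 - real i)"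
    by (simp add: H_def)
  ultimately have "(\<Sum>i<n. H $$ (i, i)) = 0"
    by (simp only: of_real_0)
  then have H: "H \<in> cartan n"
    by (auto simp: cartan_def special_linear_def diagonal_mat_def H_def)
  have pos: "Re (\<beta> H) \<ge> 1" if "\<beta> \<in> positive_roots n" for \<beta>
    using that H by (auto simp: positive_roots_def eps_def H_def)
  have bound: "m \<beta> \<le> nat \<lfloor>Re (\<xi> H)\<rfloor>"
    if "(\<lambda>H. \<Sum>\<beta> \<in> positive_roots n. of_nat (m \<beta>) * \<beta> H) = \<xi>" "\<beta> \<in> positive_roots n"
    for m :: "weight \<Rightarrow> nat" and \<beta>
  proof -
    have "real (m \<beta>) \<le> real (m \<beta>) * Re (\<beta> H)"
      using pos[OF that(2)] mult_left_mono[of 1 "Re (\<beta> H)" "real (m \<beta>)"] by simp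
    also have "\<dots> \<le> (\<Sum>\<beta> \<in> positive_roots n. real (m \<beta>) * Re (\<beta> H))"
      using that(2) finite_positive_roots pos
      by (intro member_le_sum mult_nonneg_nonneg) (auto intro: order_trans[OF zero_le_one])
    also have "\<dots> = Re (\<xi> H)"
      unfolding that(1)[symmetric] by simp
    finally show ?thesis
      by linarith
  qed
  show ?thesis
  proof (rule finite_subset)
    show "{m \<in> positive_roots n \<rightarrow>\<^sub>E (UNIV :: nat set).
             (\<lambda>H. \<Sum>\<beta> \<in> positive_roots n. of_nat (m \<beta>) * \<beta> H) = \<xi>}
          \<subseteq> positive_roots n \<rightarrow>\<^sub>E {..nat \<lfloor>Re (\<xi> H)\<rfloor>}"
      using bound by (fastforce simp: PiE_iff)
  qed (auto intro: finite_PiE finite_positive_roots)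
qed

end

theory Submission
  imports Defs
begin

text \<open>
  A weight whose integer coordinates \<open>c\<^sub>0, \<dots>, c\<^bsub>n-1\<^esub>\<close> add up to 0 is a non-negative
  integral sum of positive roots exactly when every partial sum
  \<open>c\<^sub>0 + \<dots> + c\<^bsub>k-1\<^esub>\<close> is non-negative: these partial sums are its coefficients with respect
  to the simple roots (\<open>kostant_partition_pos_iff\<close>). Write \<open>\<tau>\<close> for the inverse of
  \<open>\<sigma>\<close> and number positions from 0. Since the coordinates of \<open>\<rho>\<close> decrease in steps of 1, the
  weight \<open>\<sigma>(\<alpha> + \<rho>) - \<rho>\<close>, for \<open>\<alpha>\<close> the highest root, has the integer coordinates
  \<open>[\<tau> k = 0] - [\<tau> k = n - 1] + k - \<tau> k\<close>
  (\<open>shifted_weight_eq_coef_weight\<close>).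

  Summation over \<open>j < k\<close> turns membership in the alternation set into a bound on
  \<open>D\<^sub>k = \<Sum>j<k. \<tau> j - j\<close>. This number is never negative, because the \<open>\<tau> j\<close> are
  distinct. The first partial sum forces \<open>\<tau> 0 = 0\<close>; from then on the condition says
  \<open>D\<^sub>k \<le> 1\<close> as long as the value \<open>n - 1\<close> has not occurred, and \<open>D\<^sub>k = 0\<close> once it has.
  Thus the values on an initial segment either fill it or miss only its last element, with the
  next number in its place. The second case must be repaired by the very next value, so
  \<open>\<tau>\<close> is a product of disjoint transpositions of neighbours, all strictly between \<open>0\<close> and
  \<open>n - 1\<close>; conversely, all such products occur
  (\<open>partial_sums_nonneg_iff_near_identity\<close>). They are the permutations that move no point by
  more than 1. This condition is invariant under inversion, so \<open>\<sigma>\<close> satisfies it too.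

  It remains to count such permutations of \<open>n - 2 = r - 1\<close> consecutive points. Either the last
  point is fixed, or it is exchanged with its predecessor; this is the Fibonacci recursion
  (\<open>card_near_identity_perms\<close>).
\<close>

section \<open>Kostant's partition function and partial sums\<close>

definition coef_weight :: "nat \<Rightarrow> (nat \<Rightarrow> complex) \<Rightarrow> weight" where
  "coef_weight n c = (\<lambda>H. if H \<in> cartan n then \<Sum>i<n. c i * H $$ (i, i) else 0)"

text \<open>
  For \<open>0 < k < n\<close>, the element of the Cartan subalgebra on which the \<open>k\<close>-th simple root is 1 and the others are 0:
  the first \<open>k\<close> diagonal entries are raised by 1, and a scalar matrix is subtracted to make the
  trace vanish. A weight whose coordinates add up to 0 does not see the scalar matrix, so evaluation
  here reads off a partial sum of its coordinates.
\<close>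

definition fundamental_coweight :: "nat \<Rightarrow> nat \<Rightarrow> complex mat" where
  "fundamental_coweight n k = mat n n (\<lambda>(i, j).
     if i = j then of_bool (i < k) - of_nat k / of_nat n else 0)"

lemma sum_of_bool_less:
  assumes "k \<le> (n::nat)"
  shows "(\<Sum>i<n. c i * of_bool (i < k)) = (\<Sum>i<k. c i :: 'a::semiring_1)"
proof -
  have "{..<n} \<inter> {i. i < k} = {..<k}"
    using assms by auto
  then show ?thesis
    by (simp add: sum_mult_of_bool_eq)
qed

lemma fundamental_coweight_in_cartan:
  assumes "k \<le> n" "0 < n"
  shows "fundamental_coweight n k \<in> cartan n"
  using assms sum_of_bool_less[OF assms(1), of "\<lambda>_. 1 :: complex"]
  by (auto simp: cartan_def special_linear_def diagonal_mat_def fundamental_coweight_def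
      sum_subtractf)

lemma coef_weight_fundamental_coweight:
  assumes "k \<le> n" "0 < n" "(\<Sum>i<n. c i) = 0"
  shows "coef_weight n c (fundamental_coweight n k) = (\<Sum>i<k. c i)"
proof -
  have "coef_weight n c (fundamental_coweight n k)
      = (\<Sum>i<n. c i * of_bool (i < k) - c i * (of_nat k / of_nat n))"
    using fundamental_coweight_in_cartan[OF assms(1,2)]
    by (simp add: coef_weight_def fundamental_coweight_def algebra_simps)
  also have "\<dots> = (\<Sum>i<n. c i * of_bool (i < k)) - (\<Sum>i<n. c i) * (of_nat k / of_nat n)"
    by (simp only: sum_subtractf sum_distrib_right)
  also have "\<dots> = (\<Sum>i<k. c i)"
    using sum_of_bool_less[OF assms(1), of c] assms(3) by simp
  finally show ?thesis .
qed

text \<open>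
  A positive root is a sum of consecutive simple roots, each with coefficient 1, and the
  coweight extracts the coefficient of one simple root. These values serve twice: they are
  non-negative, and together they determine the root.
\<close>

lemma root_fundamental_coweight:
  assumes "k \<le> n" "i < j" "j < n"
  shows "(eps n i - eps n j) (fundamental_coweight n k) = of_bool (i < k \<and> k \<le> j)"
  using assms fundamental_coweight_in_cartan[of k n]
  by (auto simp: eps_def fundamental_coweight_def)

lemma summation_by_parts:
  fixes c h :: "nat \<Rightarrow> 'a::comm_ring"
  shows "(\<Sum>k<N. (\<Sum>i<Suc k. c i) * (h k - h (Suc k)))
    = (\<Sum>k<N. c k * h k) - (\<Sum>i<N. c i) * h N"
  by (induction N) (auto simp: algebra_simps)

text \<open>
  The partial sums are the coefficients with respect to the simple roots. Each coefficient is
  the value at a fundamental coweight, where all positive roots are non-negative; and when the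
  coefficients are non-negative, they are themselves the multiplicities of a partition into simple roots.
\<close>

lemma kostant_partition_pos_iff:
  assumes n: "0 < n" and c: "(\<Sum>i<n. c i) = (0::int)"
  shows "kostant_partition n (coef_weight n (\<lambda>i. of_int (c i))) > 0
    \<longleftrightarrow> (\<forall>k\<le>n. (\<Sum>i<k. c i) \<ge> 0)" (is "?K > 0 \<longleftrightarrow> ?S")
proof
  let ?\<xi> = "coef_weight n (\<lambda>i. of_int (c i))"
  assume "?K > 0"
  then obtain m :: "weight \<Rightarrow> nat"
    where m: "(\<lambda>H. \<Sum>\<beta> \<in> positive_roots n. of_nat (m \<beta>) * \<beta> H) = ?\<xi>"
    unfolding kostant_partition_def card_gt_0_iff by blast
  have c': "(\<Sum>i<n. of_int (c i)) = (0::complex)"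
    using c by (metis of_int_0 of_int_sum)
  show ?S
  proof (intro allI impI)
    fix k assume k: "k \<le> n"
    let ?H = "fundamental_coweight n k"
    have "Re (\<beta> ?H) \<ge> 0" if "\<beta> \<in> positive_roots n" for \<beta>
      using that root_fundamental_coweight[OF k] by (auto simp: positive_roots_def simp del: minus_apply)
    then have "0 \<le> (\<Sum>\<beta> \<in> positive_roots n. real (m \<beta>) * Re (\<beta> ?H))"
      by (intro sum_nonneg) auto
    also have "\<dots> = Re (?\<xi> ?H)"
      unfolding m[symmetric] by simp
    also have "\<dots> = real_of_int (\<Sum>i<k. c i)"
      unfolding coef_weight_fundamental_coweight[OF k n c'] by simp
    finally show "(\<Sum>i<k. c i) \<ge> 0"
      by linarith
  qed
next
  assume S: ?S
  define s where "s k = nat (\<Sum>i<Suc k. c i)" for k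
  define \<alpha> where "\<alpha> k = eps n k - eps n (Suc k)" for k
  have s: "(of_nat (s k) :: complex) = (\<Sum>i<Suc k. of_int (c i))" if "k < n - 1" for k
  proof -
    have "int (s k) = (\<Sum>i<Suc k. c i)"
      using S that by (auto simp: s_def simp del: sum.lessThan_Suc)
    then show ?thesis
      by (metis of_int_of_nat_eq of_int_sum)
  qed
  have \<alpha>: "\<alpha> k \<in> positive_roots n" if "k < n - 1" for k
    unfolding \<alpha>_def positive_roots_def using that
    by (intro CollectI exI[of _ k] exI[of _ "Suc k"]) auto
  (* Written as a sum over k, the multiplicity lets the double sum below collapse to one term
     for each simple root when the summations are swapped. *)
  define m where "m = restrict (\<lambda>\<beta>. \<Sum>k<n - 1. if \<beta> = \<alpha> k then s k else 0) (positive_roots n)"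
  have "(\<Sum>\<beta> \<in> positive_roots n. of_nat (m \<beta>) * \<beta> H) = coef_weight n (\<lambda>i. of_int (c i)) H"
    for H
  proof -
    have "(\<Sum>\<beta> \<in> positive_roots n. of_nat (m \<beta>) * \<beta> H)
        = (\<Sum>\<beta> \<in> positive_roots n. \<Sum>k<n - 1. if \<beta> = \<alpha> k then of_nat (s k) * \<alpha> k H else 0)"
      by (auto simp: m_def sum_distrib_right intro!: sum.cong)
    also have "\<dots> = (\<Sum>k<n - 1. of_nat (s k) * \<alpha> k H)"
      using \<alpha> by (subst sum.swap) (auto simp: sum.delta finite_positive_roots intro!: sum.cong)
    also have "\<dots> = coef_weight n (\<lambda>i. of_int (c i)) H"
    proof (cases "H \<in> cartan n")
      case True
      have "(\<Sum>k<n - 1. of_nat (s k) * \<alpha> k H)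
          = (\<Sum>k<n - 1. (\<Sum>i<Suc k. of_int (c i)) * (H $$ (k, k) - H $$ (Suc k, Suc k)))"
        using True s by (intro sum.cong) (auto simp: \<alpha>_def eps_def)
      also have "\<dots> = (\<Sum>k<n - 1. of_int (c k) * H $$ (k, k))
          - (\<Sum>i<n - 1. of_int (c i)) * H $$ (n - 1, n - 1)"
        by (rule summation_by_parts)
      (* The coefficient of the last coordinate is the boundary term of the summation by parts,
         because all coordinates add up to 0. *)
      also have "(\<Sum>i<n - 1. of_int (c i)) = - (of_int (c (n - 1)) :: complex)"
      proof -
        have "(\<Sum>i<n - 1. c i) = - c (n - 1)"
          using n c by (cases n) auto
        then show ?thesis
          by (metis of_int_minus of_int_sum)
      qed
      finally show ?thesis
        using n True by (cases n) (auto simp: coef_weight_def)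
    next
      case False
      then show ?thesis
        by (simp add: \<alpha>_def eps_def coef_weight_def)
    qed
    finally show ?thesis .
  qed
  moreover have "m \<in> positive_roots n \<rightarrow>\<^sub>E UNIV"
    by (simp add: m_def)
  ultimately show "?K > 0"
    unfolding kostant_partition_def card_gt_0_iff using finite_kostant by blast
qed

section \<open>The weights of the alternation set in coordinates\<close>

text \<open>
  The set of positive roots is defined as a set of functionals on trace-zero matrices, on which the
  coordinate functionals are linearly dependent. To turn a sum over this set into a sum over pairs of
  indices, the pair must be recoverable from the functional.
\<close>

lemma positive_root_determines_indices:
  assumes "eps n i - eps n j = eps n i' - eps n j'" "i < j" "j < n" "i' < j'" "j' < n"
  shows "i = i' \<and> j = j'"
proof -
  have "(i < k \<and> k \<le> j) = (i' < k \<and> k \<le> j')" if "k \<le> n" for k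
    using root_fundamental_coweight[of k n i j] root_fundamental_coweight[of k n i' j'] assms that
    by (simp add: of_bool_eq_iff del: minus_apply)
  from this[of j] this[of j'] this[of "Suc i"] this[of "Suc i'"] assms show ?thesis
    by auto
qed

text \<open>
  The coordinate \<open>h i\<close> enters positively for each of the \<open>N - 1 - i\<close> larger indices and negatively for
  each of the \<open>i\<close> smaller ones.
\<close>

lemma sum_pairwise_differences:
  fixes h :: "nat \<Rightarrow> complex"
  shows "(\<Sum>j<N. \<Sum>i<j. h i - h j) = (\<Sum>i<N. (of_nat N - 1 - 2 * of_nat i) * h i)"
proof (induction N)
  case (Suc N)
  have "(\<Sum>i<Suc N. (of_nat (Suc N) - 1 - 2 * of_nat i) * h i)
     = (\<Sum>i<N. (of_nat N - 1 - 2 * of_nat i) * h i) + (\<Sum>i<N. h i) - of_nat N * h N"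
    by (simp add: sum.distrib[symmetric] algebra_simps)
  then show ?case
    using Suc by (simp add: sum_subtractf)
qed simp

lemma rho_eq_coef_weight:
  "rho n = coef_weight n (\<lambda>i. (of_nat n - 1) / 2 - of_nat i)"
proof
  fix H
  let ?P = "SIGMA j:{..<n}. {..<j}"
  let ?root = "\<lambda>(j, i). eps n i - eps n j"
  have inj: "inj_on ?root ?P"
    using positive_root_determines_indices by (fastforce simp: inj_on_def)
  have roots: "positive_roots n = ?root ` ?P"
    by (force simp: positive_roots_def)
  have "rho n H = 1 / 2 * (\<Sum>j<n. \<Sum>i<j. (eps n i - eps n j) H)"
    unfolding rho_def roots sum.reindex[OF inj]
    by (subst sum.Sigma) (auto simp: case_prod_unfold)
  also have "\<dots> = coef_weight n (\<lambda>i. (of_nat n - 1) / 2 - of_nat i) H"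
  proof (cases "H \<in> cartan n")
    case True
    then have "1 / 2 * (\<Sum>j<n. \<Sum>i<j. (eps n i - eps n j) H)
        = 1 / 2 * (\<Sum>j<n. \<Sum>i<j. H $$ (i, i) - H $$ (j, j))"
      by (simp add: eps_def)
    also have "\<dots> = coef_weight n (\<lambda>i. (of_nat n - 1) / 2 - of_nat i) H"
      unfolding sum_pairwise_differences
      using True by (auto simp: coef_weight_def sum_distrib_left field_simps intro!: sum.cong)
    finally show ?thesis .
  next
    case False
    then show ?thesis
      by (simp add: eps_def coef_weight_def)
  qed
  finally show "rho n H = coef_weight n (\<lambda>i. (of_nat n - 1) / 2 - of_nat i) H" .
qed

text \<open>
  The \<open>k\<close>-th coordinate of \<open>\<sigma>(\<alpha> + \<rho>) - \<rho>\<close>, with \<open>\<alpha>\<close> the highest root and \<open>\<tau>\<close> the inverse of \<open>\<sigma>\<close>.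
  The constants \<open>(n - 1) / 2\<close> of the two copies of \<open>\<rho>\<close> cancel, which leaves an integer.
\<close>

definition shifted_coef :: "nat \<Rightarrow> (nat \<Rightarrow> nat) \<Rightarrow> nat \<Rightarrow> int" where
  "shifted_coef n \<tau> k = of_bool (\<tau> k = 0) - of_bool (\<tau> k = n - 1) + int k - int (\<tau> k)"

lemma weyl_act_coef_weight:
  assumes "\<sigma> permutes {0..<n}"
  shows "weyl_act n \<sigma> (coef_weight n c) = coef_weight n (\<lambda>k. c (inv_into UNIV \<sigma> k))"
proof
  fix H
  have \<sigma>: "\<sigma> permutes {..<n}"
    using assms by (simp add: atLeast0LessThan)
  have "(\<Sum>i<n. c (inv_into UNIV \<sigma> i) * H $$ (i, i)) = (\<Sum>i<n. c i * H $$ (\<sigma> i, \<sigma> i))"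
    by (subst sum.permute[OF \<sigma>]) (simp add: permutes_inverses[OF \<sigma>])
  then show "weyl_act n \<sigma> (coef_weight n c) H = coef_weight n (\<lambda>k. c (inv_into UNIV \<sigma> k)) H"
    using permuted_in_cartan[OF assms] by (simp add: weyl_act_def coef_weight_def)
qed

lemma coef_weight_add: "coef_weight n c + coef_weight n d = coef_weight n (\<lambda>i. c i + d i)"
  and coef_weight_diff: "coef_weight n c - coef_weight n d = coef_weight n (\<lambda>i. c i - d i)"
  by (auto simp: coef_weight_def fun_eq_iff sum.distrib sum_subtractf algebra_simps)

lemma highest_root_eq_coef_weight:
  assumes "0 < n"
  shows "highest_root n = coef_weight n (\<lambda>i. of_bool (i = 0) - of_bool (i = n - 1))"
  using assms
  by (auto simp: highest_root_def coef_weight_def eps_def fun_eq_iff left_diff_distrib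
      sum_subtractf of_bool_def if_distrib[of "\<lambda>x. x * _"] cong: if_cong)

lemma shifted_weight_eq_coef_weight:
  assumes "\<sigma> permutes {0..<n}" "0 < n"
  shows "weyl_act n \<sigma> (highest_root n + rho n) - (0 + rho n)
    = coef_weight n (\<lambda>k. of_int (shifted_coef n (inv_into UNIV \<sigma>) k))"
  by (simp add: highest_root_eq_coef_weight[OF assms(2)] rho_eq_coef_weight coef_weight_add
      coef_weight_diff weyl_act_coef_weight[OF assms(1)] shifted_coef_def algebra_simps)

lemma sum_shifted_coef:
  assumes "\<tau> permutes {0..<n}" "0 < n"
  shows "(\<Sum>k<n. shifted_coef n \<tau> k) = 0"
proof -
  have \<tau>: "\<tau> permutes {..<n}"
    using assms by (simp add: atLeast0LessThan)
  let ?g = "\<lambda>x. of_bool (x = 0) - of_bool (x = n - 1) - int x"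
  have "(\<Sum>k<n. shifted_coef n \<tau> k) = (\<Sum>k<n. ?g (\<tau> k)) + (\<Sum>k<n. int k)"
    by (simp add: shifted_coef_def sum.distrib[symmetric] algebra_simps)
  also have "(\<Sum>k<n. ?g (\<tau> k)) = (\<Sum>k<n. ?g k)"
    using sum.permute[OF \<tau>, of ?g] by (simp add: o_def)
  also have "\<dots> + (\<Sum>k<n. int k) = 0"
    using assms(2) by (simp add: sum_subtractf of_bool_def)
  finally show ?thesis .
qed

section \<open>Permutations with displacement at most one\<close>

definition near_identity_perms :: "nat \<Rightarrow> nat \<Rightarrow> (nat \<Rightarrow> nat) set" where
  "near_identity_perms a m =
     {\<sigma>. \<sigma> permutes {a..<a + m} \<and> (\<forall>k. \<sigma> k \<le> Suc k \<and> k \<le> Suc (\<sigma> k))}"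

lemma inv_near_identity_perms:
  assumes "\<sigma> \<in> near_identity_perms a m"
  shows "inv_into UNIV \<sigma> \<in> near_identity_perms a m"
proof -
  have \<sigma>: "\<sigma> permutes {a..<a + m}" and near: "\<sigma> k \<le> Suc k \<and> k \<le> Suc (\<sigma> k)" for k
    using assms by (auto simp: near_identity_perms_def)
  have "inv_into UNIV \<sigma> k \<le> Suc k \<and> k \<le> Suc (inv_into UNIV \<sigma> k)" for k
    using near[of "inv_into UNIV \<sigma> k"] by (simp add: permutes_inverses[OF \<sigma>])
  then show ?thesis
    using permutes_inv[OF \<sigma>] by (simp add: near_identity_perms_def)
qed

lemma inv_in_near_identity_perms_iff:
  assumes "\<sigma> permutes S"
  shows "inv_into UNIV \<sigma> \<in> near_identity_perms a m \<longleftrightarrow> \<sigma> \<in> near_identity_perms a m"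
  using inv_near_identity_perms[of \<sigma>] inv_near_identity_perms[of "inv_into UNIV \<sigma>"]
    permutes_inv_inv[OF assms] by auto

lemma finite_near_identity_perms: "finite (near_identity_perms a m)"
  by (rule finite_subset[OF _ finite_permutations[of "{a..<a + m}"]])
    (auto simp: near_identity_perms_def)

text \<open>
  If the last point is not fixed, its image and its preimage both have to be its predecessor, so
  the permutation exchanges the two; undoing this exchange leaves the remaining points alone.
\<close>

lemma near_identity_perms_Suc_Suc:
  fixes a m
  defines "t \<equiv> transpose (a + m) (Suc (a + m))"
  shows "near_identity_perms a (Suc (Suc m)) =
    near_identity_perms a (Suc m) \<union> (\<lambda>\<sigma>. \<sigma> \<circ> t) ` near_identity_perms a m" (is "?L = ?A \<union> ?B")
proof (intro equalityI subsetI)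
  fix \<sigma> assume "\<sigma> \<in> ?L"
  then have \<sigma>: "\<sigma> permutes {a..<a + Suc (Suc m)}" and near: "\<sigma> k \<le> Suc k \<and> k \<le> Suc (\<sigma> k)" for k
    by (auto simp: near_identity_perms_def)
  show "\<sigma> \<in> ?A \<union> ?B"
  proof (cases "\<sigma> (Suc (a + m)) = Suc (a + m)")
    case True
    have "\<sigma> permutes {a..<a + Suc m}"
      by (rule permutes_superset[OF \<sigma>]) (use True in \<open>auto simp: not_less less_Suc_eq\<close>)
    then show ?thesis
      using near by (simp add: near_identity_perms_def)
  next
    case False
    have "\<sigma> (Suc (a + m)) < a + Suc (Suc m)"
      using permutes_in_image[OF \<sigma>, of "Suc (a + m)"] by simp
    then have last: "\<sigma> (Suc (a + m)) = a + m"
      using False near[of "Suc (a + m)"] by linarith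
    obtain j where j: "\<sigma> j = Suc (a + m)"
      using permutes_surj[OF \<sigma>] by (metis surjD)
    have "j < a + Suc (Suc m)"
      using permutes_in_image[OF \<sigma>, of j] j by simp
    moreover have "j \<noteq> Suc (a + m)"
      using j False by auto
    ultimately have "j = a + m"
      using near[of j] j by linarith
    with j have prev: "\<sigma> (a + m) = Suc (a + m)"
      by simp
    let ?\<pi> = "\<sigma> \<circ> t"
    have t: "t permutes {a..<a + Suc (Suc m)}"
      unfolding t_def by (rule permutes_swap_id) auto
    have "?\<pi> permutes {a..<a + m}"
      by (rule permutes_superset[OF permutes_compose[OF t \<sigma>]])
        (use last prev in \<open>auto simp: t_def transpose_def not_less less_Suc_eq\<close>)
    moreover have "?\<pi> k \<le> Suc k \<and> k \<le> Suc (?\<pi> k)" for k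
      using near[of k] last prev by (auto simp: t_def transpose_def)
    ultimately have "?\<pi> \<in> near_identity_perms a m"
      by (auto simp: near_identity_perms_def)
    moreover have "\<sigma> = ?\<pi> \<circ> t"
      by (simp add: comp_assoc t_def)
    ultimately show ?thesis
      by blast
  qed
next
  fix \<sigma> assume "\<sigma> \<in> ?A \<union> ?B"
  then show "\<sigma> \<in> ?L"
  proof
    assume "\<sigma> \<in> ?A"
    then show ?thesis
      by (auto simp: near_identity_perms_def intro: permutes_subset)
  next
    assume "\<sigma> \<in> ?B"
    then obtain \<pi> where \<pi>: "\<pi> permutes {a..<a + m}" "\<And>k. \<pi> k \<le> Suc k \<and> k \<le> Suc (\<pi> k)"
      and \<sigma>: "\<sigma> = \<pi> \<circ> t"
      by (auto simp: near_identity_perms_def)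
    have "t permutes {a..<a + Suc (Suc m)}"
      unfolding t_def by (rule permutes_swap_id) auto
    moreover have "\<pi> permutes {a..<a + Suc (Suc m)}"
      by (rule permutes_subset[OF \<pi>(1)]) auto
    ultimately have "\<sigma> permutes {a..<a + Suc (Suc m)}"
      unfolding \<sigma> by (rule permutes_compose)
    moreover have "\<pi> (a + m) = a + m" "\<pi> (Suc (a + m)) = Suc (a + m)"
      using permutes_not_in[OF \<pi>(1)] by auto
    then have "\<sigma> k \<le> Suc k \<and> k \<le> Suc (\<sigma> k)" for k
      using \<pi>(2)[of k] by (auto simp: \<sigma> t_def transpose_def)
    ultimately show ?thesis
      by (simp add: near_identity_perms_def)
  qed
qed

lemma card_near_identity_perms: "card (near_identity_perms a m) = fib (Suc m)"
proof (induction m rule: fib.induct)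
  case 1
  have "near_identity_perms a 0 = {id}"
    by (auto simp: near_identity_perms_def)
  then show ?case
    by simp
next
  case 2
  have "near_identity_perms a (Suc 0) = {id}"
    by (auto simp: near_identity_perms_def)
  then show ?case
    by simp
next
  case (3 m)
  define t where "t = transpose (a + m) (Suc (a + m))"
  (* The two parts are told apart by the image of the last point. *)
  have "\<sigma> (Suc (a + m)) = Suc (a + m)" if "\<sigma> \<in> near_identity_perms a (Suc m)" for \<sigma>
    using that permutes_not_in[of \<sigma> "{a..<a + Suc m}"] by (simp add: near_identity_perms_def)
  moreover have "(\<sigma> \<circ> t) (Suc (a + m)) = a + m" if "\<sigma> \<in> near_identity_perms a m" for \<sigma>
    using that permutes_not_in[of \<sigma> "{a..<a + m}"] by (simp add: near_identity_perms_def t_def)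
  ultimately have disjoint:
    "near_identity_perms a (Suc m) \<inter> (\<lambda>\<sigma>. \<sigma> \<circ> t) ` near_identity_perms a m = {}"
    by (metis (no_types, lifting) disjoint_iff imageE n_not_Suc_n)
  have inj: "inj_on (\<lambda>\<sigma>. \<sigma> \<circ> t) (near_identity_perms a m)"
  proof (rule inj_on_inverseI)
    show "(\<sigma> \<circ> t) \<circ> t = \<sigma>" for \<sigma> :: "nat \<Rightarrow> nat"
      by (simp add: comp_assoc t_def)
  qed
  show ?case
    using 3 unfolding near_identity_perms_Suc_Suc t_def[symmetric]
    by (simp add: card_Un_disjoint[OF finite_near_identity_perms
        finite_imageI[OF finite_near_identity_perms] disjoint] card_image[OF inj])
qed

section \<open>Partial sums and displacement\<close>

text \<open>
  The two situations that can occur after \<open>k\<close> values of \<open>\<tau>\<close>. Either they fill the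
  initial segment, or they lack only its last element \<open>l = k - 1\<close> and contain \<open>k\<close> in its place.
  The partial sum is 1, due to the value 0 taken at 0, minus the excess of these values over \<open>0, \<dots>, k - 1\<close>.
  The bounds \<open>0 < l\<close> and \<open>k < n - 1\<close> record that neither 0 nor \<open>n - 1\<close> takes part in an exchange.
\<close>

definition initial_profile :: "nat \<Rightarrow> (nat \<Rightarrow> nat) \<Rightarrow> nat \<Rightarrow> bool" where
  "initial_profile n \<tau> k \<longleftrightarrow>
     \<tau> ` {..<k} = {..<k} \<and> (\<Sum>i<k. shifted_coef n \<tau> i) = 1 \<or>
     (\<exists>l. 0 < l \<and> k = Suc l \<and> k < n - 1 \<and>
        \<tau> ` {..<k} = insert k {..<l} \<and> (\<Sum>i<k. shifted_coef n \<tau> i) = 0)"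

text \<open>
  In each situation only one or two next values are possible. After a full segment the next
  value is at least \<open>k\<close>, and at most \<open>k + 1\<close>; after a gap the next value must fill it. The
  assumption \<open>step\<close> offers two reasons for this: the next partial sum is non-negative, or no
  point is moved by more than 1. The two directions of the characterisation use one reason each.
\<close>

lemma initial_profile_Suc:
  assumes "inj \<tau>" "initial_profile n \<tau> k" "0 < k" "k < n - 1"
    and step: "(\<Sum>i<Suc k. shifted_coef n \<tau> i) \<ge> 0 \<or>
      \<tau> (n - 1) = n - 1 \<and> (\<forall>j. \<tau> j \<le> Suc j \<and> j \<le> Suc (\<tau> j)) \<and> surj \<tau>"
  shows "initial_profile n \<tau> (Suc k) \<and> \<tau> k \<le> Suc k \<and> k \<le> Suc (\<tau> k)"
proof -
  have new: "\<tau> k \<notin> \<tau> ` {..<k}"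
    using assms(1) by (auto dest: injD)
  consider
      (full) "\<tau> ` {..<k} = {..<k}" "(\<Sum>i<k. shifted_coef n \<tau> i) = 1"
    | (gap) l where "0 < l" "k = Suc l"
        "\<tau> ` {..<k} = insert k {..<l}" "(\<Sum>i<k. shifted_coef n \<tau> i) = 0"
    using assms(2) by (auto simp: initial_profile_def)
  then show ?thesis
  proof cases
    case full
    have ge: "k \<le> \<tau> k"
      using new full by auto
    have "\<tau> k \<le> Suc k \<and> \<tau> k \<noteq> n - 1"
      using step
    proof
      assume "(\<Sum>i<Suc k. shifted_coef n \<tau> i) \<ge> 0"
      then show ?thesis
        using full ge assms(3,4) by (auto simp: shifted_coef_def of_bool_def split: if_splits)
    next
      assume "\<tau> (n - 1) = n - 1 \<and> (\<forall>j. \<tau> j \<le> Suc j \<and> j \<le> Suc (\<tau> j)) \<and> surj \<tau>"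
      then show ?thesis
        using assms(1,4) by (metis injD less_irrefl)
    qed
    with ge have "\<tau> k = k \<or> \<tau> k = Suc k \<and> Suc k < n - 1"
      using assms(4) by linarith
    then show ?thesis
      using full assms(3,4)
      by (auto simp: initial_profile_def shifted_coef_def lessThan_Suc)
  next
    case (gap l)
    have "\<tau> k = l"
      using step
    proof
      assume "(\<Sum>i<Suc k. shifted_coef n \<tau> i) \<ge> 0"
      moreover have "l \<le> \<tau> k" "\<tau> k \<noteq> k"
        using new gap by auto
      ultimately show ?thesis
        using gap by (auto simp: shifted_coef_def of_bool_def split: if_splits)
    next
      assume near: "\<tau> (n - 1) = n - 1 \<and> (\<forall>j. \<tau> j \<le> Suc j \<and> j \<le> Suc (\<tau> j)) \<and> surj \<tau>"
      (* The point that is sent to l has not occurred before k and lies within distance 1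
         of l, so it is k. *)
      then obtain j where j: "\<tau> j = l"
        by (metis surjD)
      have "l \<notin> \<tau> ` {..<k}"
        using gap by auto
      then have "k \<le> j"
        using j by (metis imageI lessThan_iff not_le)
      moreover have "j \<le> Suc l"
        using near j by auto
      ultimately show ?thesis
        using gap j by simp
    qed
    have "\<tau> ` {..<Suc k} = insert l (insert (Suc l) {..<l})"
      using gap \<open>\<tau> k = l\<close> by (simp only: lessThan_Suc image_insert)
    also have "\<dots> = {..<Suc k}"
      using gap by auto
    finally show ?thesis
      using \<open>\<tau> k = l\<close> gap assms(4) by (auto simp: initial_profile_def shifted_coef_def)
  qed
qed

text \<open>
  A profile stops short of the value \<open>n - 1\<close>: the case with a gap is excluded for \<open>k = n - 1\<close>,
  so the first \<open>n - 1\<close> values fill their segment and leave \<open>n - 1\<close> for the last point.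
\<close>

lemma initial_profile_last:
  assumes "\<tau> permutes {0..<n}" "2 \<le> n" "initial_profile n \<tau> (n - 1)"
  shows "\<tau> (n - 1) = n - 1"
proof -
  have "\<tau> ` {..<n - 1} = {..<n - 1}"
    using assms(3) by (auto simp: initial_profile_def)
  moreover have "\<tau> (n - 1) \<notin> \<tau> ` {..<n - 1}"
    using permutes_inj[OF assms(1)] by (auto dest: injD)
  moreover have "\<tau> (n - 1) < n"
    using permutes_in_image[OF assms(1), of "n - 1"] assms(2) by simp
  ultimately show ?thesis
    by auto
qed

text \<open>
  Both directions carry the profile from \<open>k = 1\<close> up to \<open>k = n - 1\<close>. The profile contains the
  partial sum, which is 0 or 1, and the complete sum over all \<open>n\<close> coordinates vanishes.
\<close>

lemma partial_sums_nonneg_iff_near_identity: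
  assumes \<tau>: "\<tau> permutes {0..<n}" and n: "2 \<le> n"
  shows "(\<forall>k\<le>n. (\<Sum>i<k. shifted_coef n \<tau> i) \<ge> 0) \<longleftrightarrow> \<tau> \<in> near_identity_perms 1 (n - 2)"
    (is "?S \<longleftrightarrow> ?N")
proof
  assume S: ?S
  have inj: "inj \<tau>"
    using \<tau> by (rule permutes_inj)
  (* Otherwise the first partial sum would be - \<tau> 0, lowered by 1 more if \<tau> 0 = n - 1. *)
  have zero: "\<tau> 0 = 0"
    using S[rule_format, of 1] n by (auto simp: shifted_coef_def of_bool_def split: if_splits)
  have start: "initial_profile n \<tau> (Suc 0)"
    using zero n by (auto simp: initial_profile_def shifted_coef_def)
  have profile: "initial_profile n \<tau> k" if "0 < k" "k \<le> n - 1" for k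
    using that
  proof (induction k)
    case (Suc k)
    then show ?case
      using start initial_profile_Suc[OF inj, of n k] S[rule_format, of "Suc k"]
      by (cases "k = 0") auto
  qed simp
  have last: "\<tau> (n - 1) = n - 1"
    using initial_profile_last[OF \<tau> n] profile n by simp
  have "\<tau> permutes {1..<1 + (n - 2)}"
  proof (rule permutes_superset[OF \<tau>])
    fix x assume "x \<in> {0..<n} - {1..<1 + (n - 2)}"
    then have "x = 0 \<or> x = n - 1"
      by auto
    then show "\<tau> x = x"
      using zero last by auto
  qed
  moreover have "\<tau> k \<le> Suc k \<and> k \<le> Suc (\<tau> k)" for k
  proof (cases "0 < k \<and> k < n - 1")
    case True
    then show ?thesis
      using initial_profile_Suc[OF inj profile, of k] S[rule_format, of "Suc k"] by auto
  next
    case False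
    then have "\<tau> k = k"
      using zero last permutes_not_in[OF \<tau>, of k]
      by (cases "k = 0"; cases "k = n - 1") auto
    then show ?thesis
      by simp
  qed
  ultimately show ?N
    by (simp add: near_identity_perms_def)
next
  assume ?N
  then have \<tau>': "\<tau> permutes {1..<1 + (n - 2)}" and near: "\<forall>k. \<tau> k \<le> Suc k \<and> k \<le> Suc (\<tau> k)"
    by (auto simp: near_identity_perms_def)
  have zero: "\<tau> 0 = 0" and last: "\<tau> (n - 1) = n - 1"
    by (rule permutes_not_in[OF \<tau>'], unfold atLeastLessThan_iff, use n in linarith)+
  have start: "initial_profile n \<tau> (Suc 0)"
    using zero n by (auto simp: initial_profile_def shifted_coef_def)
  have profile: "initial_profile n \<tau> k" if "0 < k" "k \<le> n - 1" for k
    using that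
  proof (induction k)
    case (Suc k)
    then show ?case
      using start initial_profile_Suc[OF permutes_inj[OF \<tau>], of n k] near last permutes_surj[OF \<tau>]
      by (cases "k = 0") auto
  qed simp
  show ?S
  proof (intro allI impI)
    fix k assume "k \<le> n"
    then consider "k = 0" | "0 < k" "k \<le> n - 1" | "k = n"
      by linarith
    then show "(\<Sum>i<k. shifted_coef n \<tau> i) \<ge> 0"
    proof cases
      case 2
      then show ?thesis
        using profile[of k] by (auto simp: initial_profile_def)
    next
      case 3
      then show ?thesis
        using sum_shifted_coef[OF \<tau>] n by simp
    qed simp
  qed
qed

section \<open>Counting the alternation set\<close>

lemma weyl_alternation_set_highest_root:
  assumes n: "2 \<le> n"
  shows "weyl_alternation_set n (highest_root n) 0 = near_identity_perms 1 (n - 2)"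
proof -
  have "kostant_partition n (weyl_act n \<sigma> (highest_root n + rho n) - (0 + rho n)) > 0
      \<longleftrightarrow> \<sigma> \<in> near_identity_perms 1 (n - 2)" if \<sigma>: "\<sigma> permutes {0..<n}" for \<sigma>
  proof -
    have pos: "0 < n"
      using n by simp
    note \<tau> = permutes_inv[OF \<sigma>]
    show ?thesis
      unfolding shifted_weight_eq_coef_weight[OF \<sigma> pos]
        kostant_partition_pos_iff[OF pos sum_shifted_coef[OF \<tau> pos]]
        partial_sums_nonneg_iff_near_identity[OF \<tau> n] inv_in_near_identity_perms_iff[OF \<sigma>] ..
  qed
  moreover have "\<sigma> permutes {0..<n}" if "\<sigma> \<in> near_identity_perms 1 (n - 2)" for \<sigma>
    by (rule permutes_subset[of \<sigma> "{1..<1 + (n - 2)}"])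
      (use that n in \<open>auto simp: near_identity_perms_def\<close>)
  ultimately show ?thesis
    by (auto simp: weyl_alternation_set_def weyl_group_def)
qed

theorem theorem2p2:
  fixes r :: nat
  assumes "r \<ge> 1"
  shows "card (weyl_alternation_set (r + 1) (highest_root (r + 1)) 0) = fib r"
  using assms by (simp add: weyl_alternation_set_highest_root card_near_identity_perms Suc_diff_le)

end
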